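(* Let $\alpha>0$. The ultraspherical weight $w_\alpha(x)=(1-x^2)^\alpha$, $x\in(-1,1)$, is symmetrically separable: with $$\mathfrak{a}_m=\sqrt{\frac{m!\,(2m+2\alpha+1)}{2\,\Gamma(m+1+2\alpha)}},\qquad \mathfrak{b}_n=\sqrt{\frac{(2n+2\alpha+1)\,\Gamma(n+1+2\alpha)}{2\,n!}},\qquad m,n\in\mathbb{Z}_+,$$ its differentiation matrix satisfies $\mathcal{D}_{m,n}=0$ if $m+n$ is even, and, if $m+n$ is odd, $\mathcal{D}_{m,n}=\mathfrak{a}_m\mathfrak{b}_n$ for $m\ge n+1$ and $\mathcal{D}_{m,n}=-\mathfrak{a}_n\mathfrak{b}_m$ for $m\le n-1$. That is, for $m+n$ odd and $m\ge n+1$, $$\mathcal{D}_{m,n}=\frac12\sqrt{\frac{m!\,(2m+2\alpha+1)(2n+2\alpha+1)\,\Gamma(n+1+2\alpha)}{n!\,\Gamma(m+1+2\alpha)}}.$$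
   Context: $\mathbb{Z}_+=\{0,1,2,\dots\}$. $\{p_n\}$ are the orthonormal polynomials with respect to $w_\alpha$ on $(-1,1)$ with positive leading coefficients, i.e. $p_n=g_n^\alpha P_n^{(\alpha,\alpha)}$ where $P_n^{(\alpha,\alpha)}$ are the Jacobi polynomials and $g_n^\alpha=\dfrac{\sqrt{\frac12 n!(2n+2\alpha+1)\Gamma(n+2\alpha+1)}}{2^\alpha\Gamma(n+\alpha+1)}$. The W-functions are $\varphi_n=\sqrt{w_\alpha}\,p_n$, and the differentiation matrix is $\mathcal{D}_{m,n}=\int_{-1}^1\varphi_m'(x)\varphi_n(x)\,dx$. A weight is symmetrically separable if there are real sequences $\{a_n\},\{b_n\}$ such that $\mathcal{D}_{m,n}=0$ for $m+n$ even and, for $m+n$ odd, $\mathcal{D}_{m,n}=a_mb_n$ if $m\ge n+1$ and $\mathcal{D}_{m,n}=-a_nb_m$ if $m\le n-1$. *)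

theory Defs
  imports "HOL-Analysis.Analysis" "HOL-Computational_Algebra.Polynomial"
begin

definition orthonormal_polys :: "real set \<Rightarrow> (real \<Rightarrow> real) \<Rightarrow> (nat \<Rightarrow> real poly) \<Rightarrow> bool" where
  "orthonormal_polys S w p \<longleftrightarrow>
     (\<forall>n. degree (p n) = n \<and> lead_coeff (p n) > 0) \<and>
     (\<forall>m n. set_integrable lborel S (\<lambda>x. w x * poly (p m) x * poly (p n) x) \<and>
            (LINT x:S|lborel. w x * poly (p m) x * poly (p n) x) = (if m = n then 1 else 0))"

text \<open>If w is nonnegative on S, not almost everywhere zero there, and has finite
  moments of all orders, then Gram-Schmidt gives exactly one such sequence; for other
  w the value below may be unspecified.\<close>

definition orthonormal_poly :: "real set \<Rightarrow> (real \<Rightarrow> real) \<Rightarrow> nat \<Rightarrow> real poly" where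
  "orthonormal_poly S w = (THE p. orthonormal_polys S w p)"

definition W_function :: "real set \<Rightarrow> (real \<Rightarrow> real) \<Rightarrow> nat \<Rightarrow> real \<Rightarrow> real" where
  "W_function S w n x = sqrt (w x) * poly (orthonormal_poly S w n) x"

definition diff_matrix :: "real set \<Rightarrow> (real \<Rightarrow> real) \<Rightarrow> nat \<Rightarrow> nat \<Rightarrow> real" where
  "diff_matrix S w m n = (LINT x:S|lborel. deriv (W_function S w m) x * W_function S w n x)"

definition symmetrically_separable_via ::
    "real set \<Rightarrow> (real \<Rightarrow> real) \<Rightarrow> (nat \<Rightarrow> real) \<Rightarrow> (nat \<Rightarrow> real) \<Rightarrow> bool" where
  "symmetrically_separable_via S w a b \<longleftrightarrow>
     (\<forall>m n. (even (m + n) \<longrightarrow> diff_matrix S w m n = 0) \<and>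
            (odd (m + n) \<and> m \<ge> n + 1 \<longrightarrow> diff_matrix S w m n = a m * b n) \<and>
            (odd (m + n) \<and> m + 1 \<le> n \<longrightarrow> diff_matrix S w m n = - (a n * b m)))"

definition symmetrically_separable :: "real set \<Rightarrow> (real \<Rightarrow> real) \<Rightarrow> bool" where
  "symmetrically_separable S w \<longleftrightarrow> (\<exists>a b. symmetrically_separable_via S w a b)"

definition ultraspherical_weight :: "real \<Rightarrow> real \<Rightarrow> real" where
  "ultraspherical_weight \<alpha> x = (1 - x\<^sup>2) powr \<alpha>"

definition ultraspherical_a :: "real \<Rightarrow> nat \<Rightarrow> real" where
  "ultraspherical_a \<alpha> m =
     sqrt (fact m * (2 * real m + 2 * \<alpha> + 1) / (2 * Gamma (real m + 1 + 2 * \<alpha>)))"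

definition ultraspherical_b :: "real \<Rightarrow> nat \<Rightarrow> real" where
  "ultraspherical_b \<alpha> n =
     sqrt ((2 * real n + 2 * \<alpha> + 1) * Gamma (real n + 1 + 2 * \<alpha>) / (2 * fact n))"

end

theory Submission imports Defs begin

text \<open>
  Write \<open>w = (1 - x\<^sup>2)\<^sup>\<alpha>\<close> and \<open>L f\<close> for the integral of \<open>w f\<close> over \<open>(-1, 1)\<close>. The product rule
  gives \<open>\<phi>\<^sub>m' \<phi>\<^sub>n = w (p\<^sub>m' p\<^sub>n - p\<^sub>m p\<^sub>n') / 2 + (w p\<^sub>m p\<^sub>n)' / 2\<close>. For \<open>\<alpha> > 0\<close> the function
  \<open>w p\<^sub>m p\<^sub>n\<close> vanishes at both endpoints and its derivative, although it may be unbounded there,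
  is integrable. Hence the last term integrates to zero and
  \<open>D\<^sub>m\<^sub>n = (L (p\<^sub>m' p\<^sub>n) - L (p\<^sub>n' p\<^sub>m)) / 2\<close> (lemma \<open>diff_matrix_ultraspherical\<close>). At most one
  of the two terms is nonzero, because \<open>p\<^sub>m'\<close> has degree \<open>m - 1\<close>.

  The polynomial \<open>p\<^sub>n\<close> is a positive multiple of the Gegenbauer polynomial \<open>C\<^sub>n\<close> with parameter
  \<open>l = \<alpha> + 1/2\<close>. The identity \<open>C\<^sub>m\<^sub>+\<^sub>2' - C\<^sub>m' = 2 (m + 1 + l) C\<^sub>m\<^sub>+\<^sub>1\<close> telescopes to
  \<open>C\<^sub>m' = 2 (m - 1 + l) C\<^sub>m\<^sub>-\<^sub>1 + 2 (m - 3 + l) C\<^sub>m\<^sub>-\<^sub>3 + \<dots>\<close>, so by orthogonality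
  \<open>L (C\<^sub>m' C\<^sub>n) = 2 (n + l) L (C\<^sub>n\<^sup>2)\<close> when \<open>n < m\<close> and \<open>m + n\<close> is odd, and zero otherwise
  (lemma \<open>gegenbauer_derivative_pairing\<close>). This depends on \<open>m\<close> only through that condition, and
  therefore normalisation leaves a product of a factor in \<open>m\<close> and a factor in \<open>n\<close>.
  The factors come out as claimed because the three-term recurrence makes
  \<open>a\<^sub>n\<^sup>2 L (C\<^sub>n\<^sup>2)\<close> independent of \<open>n\<close> (lemma \<open>gegenbauer_norm\<close>), while \<open>a\<^sub>n b\<^sub>n = n + l\<close>.

  Here \<open>C\<^sub>n\<close> is given by its recurrence. Its derivative identities follow by induction, they yield
  the differential equation, and the differential equation yields orthogonality by integration by
  parts.
\<close>

section \<open>Integration against the ultraspherical weight\<close>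

lemma integrable_left_endpoint:
  fixes a :: real
  assumes "a > 0"
  shows "set_integrable lborel {-1<..<1} (\<lambda>x. (1 + x) powr (a - 1))"
proof -
  have "set_integrable lborel (einterval (ereal (-1)) (ereal 1)) (\<lambda>x. (1 + x) powr (a - 1))"
  proof (rule interval_integral_FTC_nonneg(1)[where F = "\<lambda>x. (1 + x) powr a / a"])
    fix x :: real assume x: "ereal (-1) < ereal x" "ereal x < ereal 1"
    show "((\<lambda>x. (1 + x) powr a / a) has_real_derivative (1 + x) powr (a - 1)) (at x)"
      using x assms by (auto intro!: derivative_eq_intros)
    show "isCont (\<lambda>x. (1 + x) powr (a - 1)) x"
      using x by (intro continuous_intros) auto
  next
    have c: "continuous_on {-1..1} (\<lambda>x::real. (1 + x) powr a / a)"
      using assms by (auto intro!: continuous_intros continuous_on_powr')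
    show "(((\<lambda>x. (1 + x) powr a / a) \<circ> real_of_ereal) \<longlongrightarrow> (1 + (-1)) powr a / a) (at_right (ereal (-1)))"
      unfolding ereal_tendsto_simps1 using continuous_on_Icc_at_rightD[OF c] by simp
    show "(((\<lambda>x. (1 + x) powr a / a) \<circ> real_of_ereal) \<longlongrightarrow> (1 + 1) powr a / a) (at_left (ereal 1))"
      unfolding ereal_tendsto_simps1 using continuous_on_Icc_at_leftD[OF c] by simp
  qed auto
  thus ?thesis by (simp only: einterval_eq)
qed

lemma integrable_right_endpoint:
  fixes a :: real
  assumes "a > 0"
  shows "set_integrable lborel {-1<..<1} (\<lambda>x. (1 - x) powr (a - 1))"
proof -
  have "integrable lborel (\<lambda>x. indicator {-1<..<1} (0 + (-1) * x) *\<^sub>R (1 + (0 + (-1) * x)) powr (a - 1))"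
    using lborel_integrable_real_affine[OF integrable_left_endpoint[OF assms, unfolded set_integrable_def], of "-1" 0]
    by simp
  moreover have "(\<lambda>x::real. indicator {-1<..<1} (0 + (-1) * x) *\<^sub>R (1 + (0 + (-1) * x)) powr (a - 1)) =
      (\<lambda>x. indicator {-1<..<1} x *\<^sub>R (1 - x) powr (a - 1))"
    by (auto simp: fun_eq_iff indicator_def)
  ultimately show ?thesis
    by (simp add: set_integrable_def)
qed

text \<open>On each half of the interval only one of the factors \<open>1 - x\<close> and \<open>1 + x\<close> can approach zero.
  The other lies in \<open>[1, 2]\<close>, where its power with exponent \<open>a - 1\<close> is at most \<open>2\<^sup>a\<close>, whatever
  the sign of \<open>a - 1\<close>.\<close>

lemma weight_le_endpoint_powers:
  fixes a x :: real
  assumes "a > 0" "x \<in> {-1<..<1}"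
  shows "(1 - x\<^sup>2) powr (a - 1) \<le> 2 powr a * ((1 + x) powr (a - 1) + (1 - x) powr (a - 1))"
proof -
  have aux: "(1 - y) powr (a - 1) * (1 + y) powr (a - 1) \<le> 2 powr a * (1 - y) powr (a - 1)"
    if y: "0 \<le> y" "y < 1" for y
  proof -
    have "(1 + y) powr (a - 1) \<le> (1 + y) powr a" using y by (intro powr_mono) auto
    also have "\<dots> \<le> 2 powr a" using y assms by (intro powr_mono2) auto
    finally show ?thesis by (subst mult.commute) (rule mult_right_mono, auto)
  qed
  have fact: "(1 - x\<^sup>2) powr (a - 1) = (1 - x) powr (a - 1) * (1 + x) powr (a - 1)"
    using assms by (subst powr_mult[symmetric]) (auto simp: algebra_simps power2_eq_square)
  have nn: "0 \<le> 2 powr a * (1 + x) powr (a - 1)" "0 \<le> 2 powr a * (1 - x) powr (a - 1)" by auto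
  show ?thesis
  proof (cases "x \<ge> 0")
    case True
    have "(1 - x) powr (a - 1) * (1 + x) powr (a - 1) \<le> 2 powr a * (1 - x) powr (a - 1)"
      using aux[of x] True assms by (simp del: mult_le_cancel_left mult_le_cancel_right)
    with nn show ?thesis unfolding fact distrib_left by linarith
  next
    case False
    have "(1 - x) powr (a - 1) * (1 + x) powr (a - 1) \<le> 2 powr a * (1 + x) powr (a - 1)"
      using aux[of "-x"] False assms by (simp add: mult.commute)
    with nn show ?thesis unfolding fact distrib_left by linarith
  qed
qed

text \<open>The range \<open>a > -1\<close> is what makes the lemma apply to the weight with exponent \<open>\<alpha>\<close> and also to its
  derivative, where the exponent \<open>\<alpha> - 1\<close> may be negative.\<close>

lemma weight_poly_integrable:
  fixes a :: real and f :: "real poly"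
  assumes "a > -1"
  shows "set_integrable lborel {-1<..<1} (\<lambda>x. (1 - x\<^sup>2) powr a * poly f x)"
proof -
  have cf: "continuous_on {-1..1} (poly f)" by (intro continuous_intros)
  have "bounded (poly f ` {-1..1})"
    by (intro compact_imp_bounded compact_continuous_image[OF cf]) auto
  then obtain B where B: "\<forall>x\<in>{-1..1}. \<bar>poly f x\<bar> \<le> B" "B > 0"
    unfolding bounded_pos by auto
  define g where "g = (\<lambda>x::real. (B * 2 powr (a+1)) * ((1 + x) powr a + (1 - x) powr a))"
  have g: "set_integrable lborel {-1<..<1} g"
    using integrable_left_endpoint[of "a+1"] integrable_right_endpoint[of "a+1"] assms B(2)
    unfolding g_def by (intro set_integrable_mult_right set_integral_add) auto
  have [measurable]: "poly f \<in> borel_measurable borel"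
    by (intro borel_measurable_continuous_onI continuous_intros)
  show ?thesis
  proof (rule set_integrable_bound[OF g])
    show "set_borel_measurable lborel {-1<..<1} (\<lambda>x. (1 - x\<^sup>2) powr a * poly f x)"
      unfolding set_borel_measurable_def by measurable
    show "AE x in lborel. x \<in> {-1<..<1} \<longrightarrow> norm ((1 - x\<^sup>2) powr a * poly f x) \<le> norm (g x)"
    proof (intro AE_I2 impI)
      fix x :: real assume x: "x \<in> {-1<..<1}"
      have "(1 - x\<^sup>2) powr a * \<bar>poly f x\<bar> \<le> (2 powr (a+1) * ((1 + x) powr a + (1 - x) powr a)) * B"
        using weight_le_endpoint_powers[of "a+1" x] assms x B
        by (intro mult_mono) auto
      also have "\<dots> = g x" by (simp add: g_def)
      finally show "norm ((1 - x\<^sup>2) powr a * poly f x) \<le> norm (g x)"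
        by (simp add: abs_mult)
    qed
  qed
qed

definition weighted_integral :: "real \<Rightarrow> real poly \<Rightarrow> real" where
  "weighted_integral a f = (LINT x:{-1<..<1}|lborel. (1 - x\<^sup>2) powr a * poly f x)"

context
  fixes a :: real
  assumes a: "a > -1"
begin

lemma weighted_integral_add:
  "weighted_integral a (f + g) = weighted_integral a f + weighted_integral a g"
  unfolding weighted_integral_def
  by (simp add: distrib_left set_integral_add(2) weight_poly_integrable a)

lemma weighted_integral_diff:
  "weighted_integral a (f - g) = weighted_integral a f - weighted_integral a g"
  unfolding weighted_integral_def
  by (simp add: right_diff_distrib set_integral_diff(2) weight_poly_integrable a)

end

lemma weighted_integral_smult:
  "weighted_integral a (smult c f) = c * weighted_integral a f"
  unfolding weighted_integral_def by (simp add: mult.left_commute)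

text \<open>The integrand is the derivative of \<open>(1 - x\<^sup>2)\<^sup>b f\<close>, which vanishes at both endpoints. The case
  \<open>b = \<alpha>\<close> removes the boundary term of the differentiation matrix; the case \<open>b = \<alpha> + 1\<close> makes the
  Gegenbauer differential operator symmetric.\<close>

lemma weighted_integral_integration_by_parts:
  assumes b: "b > 0"
  shows "weighted_integral (b - 1) ([:1, 0, -1:] * pderiv f - smult (2 * b) ([:0, 1:] * f)) = 0"
proof -
  define F where "F = (\<lambda>x. (1 - x\<^sup>2) powr b * poly f x)"
  define d where "d = [:1, 0, -1:] * pderiv f - smult (2 * b) ([:0, 1:] * f)"
  have "(LBINT x=ereal (-1)..ereal 1. (1 - x\<^sup>2) powr (b - 1) * poly d x) = F 1 - F (-1)"
  proof (rule interval_integral_FTC_integrable)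
    fix x :: real assume x: "ereal (-1) < ereal x" "ereal x < ereal 1"
    have pos: "1 - x\<^sup>2 > 0" using x by (simp add: power2_less_1_iff abs_less_iff abs_square_less_1)
    have split: "(1 - x\<^sup>2) powr b = (1 - x\<^sup>2) powr (b - 1) * (1 - x\<^sup>2)"
      using pos by (simp add: powr_diff)
    have "(F has_real_derivative (1 - x\<^sup>2) powr (b - 1) * poly d x) (at x)"
      unfolding F_def using pos
      by (auto intro!: derivative_eq_intros simp: split d_def)
         (simp add: field_simps power2_eq_square)
    thus "(F has_vector_derivative (1 - x\<^sup>2) powr (b - 1) * poly d x) (at x)"
      by (simp add: has_real_derivative_iff_has_vector_derivative)
    show "isCont (\<lambda>x. (1 - x\<^sup>2) powr (b - 1) * poly d x) x"
      using pos by (intro continuous_intros) auto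
  next
    have c: "continuous_on {-1..1} F"
      unfolding F_def using b
      by (auto intro!: continuous_intros continuous_on_powr' simp: abs_square_le_1)
    show "((F \<circ> real_of_ereal) \<longlongrightarrow> F (-1)) (at_right (ereal (-1)))"
      unfolding ereal_tendsto_simps1 using continuous_on_Icc_at_rightD[OF c] by simp
    show "((F \<circ> real_of_ereal) \<longlongrightarrow> F 1) (at_left (ereal 1))"
      unfolding ereal_tendsto_simps1 using continuous_on_Icc_at_leftD[OF c] by simp
    show "set_integrable lborel (einterval (ereal (-1)) (ereal 1)) (\<lambda>x. (1 - x\<^sup>2) powr (b - 1) * poly d x)"
      using weight_poly_integrable[of "b - 1" d] b by (simp only: einterval_eq)
  qed simp
  moreover have "F 1 = 0" "F (-1) = 0" by (simp_all add: F_def)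
  ultimately show ?thesis
    unfolding weighted_integral_def d_def
    by (simp only: interval_integral_Ioo) (simp add: interval_lebesgue_integral_le_eq)
qed

text \<open>The weight is bounded below by \<open>(3/4)\<^sup>a\<close> on the middle half of the interval.\<close>

lemma weighted_integral_one_pos:
  assumes "a > 0"
  shows "weighted_integral a 1 > 0"
proof -
  have "(LINT x|lborel. indicator {-1/2..1/2::real} x *\<^sub>R (3/4::real) powr a) \<le> weighted_integral a 1"
    unfolding weighted_integral_def set_lebesgue_integral_def
  proof (rule integral_mono)
    show "integrable lborel (\<lambda>x. indicator {-1/2..1/2::real} x *\<^sub>R (3/4::real) powr a)"
      by (simp add: integrable_real_mult_indicator)
    show "integrable lborel (\<lambda>x. indicator {-1<..<1} x *\<^sub>R ((1 - x\<^sup>2) powr a * poly 1 x))"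
      using weight_poly_integrable[of a 1] assms by (simp add: set_integrable_def)
    fix x :: real
    have "(3/4) powr a \<le> (1 - x\<^sup>2) powr a" if "x \<in> {-1/2..1/2}"
    proof -
      have "\<bar>x\<bar> \<le> 1/2" using that by auto
      hence "x\<^sup>2 \<le> (1/2)\<^sup>2" by (metis abs_le_square_iff abs_of_nonneg zero_le_divide_1_iff zero_le_numeral)
      thus ?thesis using assms by (intro powr_mono2) (auto simp: power2_eq_square)
    qed
    thus "indicator {-1/2..1/2::real} x *\<^sub>R (3/4::real) powr a
          \<le> indicator {-1<..<1} x *\<^sub>R ((1 - x\<^sup>2) powr a * poly 1 x)"
      by (auto simp: indicator_def)
  qed
  moreover have "(LINT x|lborel. indicator {-1/2..1/2::real} x *\<^sub>R (3/4::real) powr a) = (3/4) powr a"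
    by simp
  moreover have "(3/4::real) powr a > 0" by simp
  ultimately show ?thesis by linarith
qed

section \<open>Gegenbauer polynomials\<close>

fun gegenbauer :: "real \<Rightarrow> nat \<Rightarrow> real poly" where
  "gegenbauer l 0 = 1"
| "gegenbauer l (Suc 0) = [:0, 2 * l:]"
| "gegenbauer l (Suc (Suc n)) =
     smult (1 / (real n + 2))
       (smult (2 * (real n + 1 + l)) ([:0, 1:] * gegenbauer l (Suc n))
        - smult (real n + 2 * l) (gegenbauer l n))"

lemma gegenbauer_recurrence:
  "smult (real n + 2) (gegenbauer l (Suc (Suc n))) =
     smult (2 * (real n + 1 + l)) ([:0, 1:] * gegenbauer l (Suc n))
     - smult (real n + 2 * l) (gegenbauer l n)"
  by (simp add: smult_diff_right del: mult_pCons_left)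

lemma poly_gegenbauer_recurrence:
  "(real n + 2) * poly (gegenbauer l (Suc (Suc n))) x =
     2 * (real n + 1 + l) * x * poly (gegenbauer l (Suc n)) x
     - (real n + 2 * l) * poly (gegenbauer l n) x"
  using arg_cong[OF gegenbauer_recurrence[of n l], of "\<lambda>f. poly f x"]
  by (simp add: mult.assoc del: gegenbauer.simps)

lemma poly_pderiv_gegenbauer_recurrence:
  "(real n + 2) * poly (pderiv (gegenbauer l (Suc (Suc n)))) x =
     2 * (real n + 1 + l) * (poly (gegenbauer l (Suc n)) x + x * poly (pderiv (gegenbauer l (Suc n))) x)
     - (real n + 2 * l) * poly (pderiv (gegenbauer l n)) x"
  using arg_cong[OF gegenbauer_recurrence[of n l], of "\<lambda>f. poly (pderiv f) x"]
  by (simp add: pderiv_smult pderiv_diff pderiv_mult pderiv_pCons algebra_simps del: gegenbauer.simps)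

lemma gegenbauer_coeffs:
  assumes "l > 0"
  shows "(\<forall>i>n. coeff (gegenbauer l n) i = 0) \<and> coeff (gegenbauer l n) n > 0"
proof (induction n rule: induct_nat_012)
  case 0 show ?case by simp
next
  case 1 show ?case using assms by (auto simp: coeff_pCons split: nat.splits)
next
  case (ge2 n)
  thus ?case using assms
    by (auto simp: coeff_pCons split: nat.splits intro!: divide_pos_pos mult_pos_pos)
qed

text \<open>The two relations are proved together: differentiating the recurrence and eliminating
  \<open>C\<^sub>n'\<close> by the first relation at \<open>n\<close> gives the second at \<open>n + 1\<close>, which combines with both
  relations at \<open>n\<close> and the recurrence to give the first at \<open>n + 1\<close>.\<close>

lemma gegenbauer_derivative_shifts:
  shows "x * poly (pderiv (gegenbauer l (Suc n))) x - poly (pderiv (gegenbauer l n)) x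
           = (real n + 1) * poly (gegenbauer l (Suc n)) x" (is "?A n")
    and "poly (pderiv (gegenbauer l (Suc n))) x
           = (real n + 2 * l) * poly (gegenbauer l n) x + x * poly (pderiv (gegenbauer l n)) x" (is "?B n")
proof -
  have "?A n \<and> ?B n"
  proof (induction n)
    case 0
    show ?case by (simp add: pderiv_pCons pderiv_1)
  next
    case (Suc n)
    let ?C = "\<lambda>k. poly (gegenbauer l k) x" and ?D = "\<lambda>k. poly (pderiv (gegenbauer l k)) x"
    have A: "?D n = x * ?D (Suc n) - (real n + 1) * ?C (Suc n)"
      using conjunct1[OF Suc.IH] by linarith
    note B = conjunct2[OF Suc.IH]
    have "(real n + 2) * ?D (Suc (Suc n)) =
            (real n + 2) * ((real n + 1 + 2 * l) * ?C (Suc n) + x * ?D (Suc n))"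
      unfolding poly_pderiv_gegenbauer_recurrence A by (simp add: algebra_simps)
    hence B': "?D (Suc (Suc n)) = (real n + 1 + 2 * l) * ?C (Suc n) + x * ?D (Suc n)"
      by (simp del: gegenbauer.simps)
    have "x * ?D (Suc (Suc n)) - ?D (Suc n) = (real n + 2) * ?C (Suc (Suc n))"
      unfolding poly_gegenbauer_recurrence B' using A B by algebra
    with B' show ?case by (simp add: add.commute del: gegenbauer.simps)
  qed
  thus "?A n" "?B n" by blast+
qed

lemma gegenbauer_derivative_difference:
  "poly (pderiv (gegenbauer l (Suc (Suc n)))) x - poly (pderiv (gegenbauer l n)) x =
     2 * (real n + 1 + l) * poly (gegenbauer l (Suc n)) x"
  using gegenbauer_derivative_shifts(1)[where n = n and l = l and x = x]
    gegenbauer_derivative_shifts(2)[where n = "Suc n" and l = l and x = x]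
  by (simp add: algebra_simps del: gegenbauer.simps)

text \<open>Proved as an identity of polynomials so that it can be differentiated; its derivative is the
  differential equation, up to one use of the first shift relation.\<close>

lemma gegenbauer_structure_relation:
  "[:1, 0, -1:] * pderiv (gegenbauer l (Suc n)) =
     smult (real n + 2 * l) (gegenbauer l n) - smult (real n + 1) ([:0, 1:] * gegenbauer l (Suc n))"
proof -
  have "(1 - x * x) * poly (pderiv (gegenbauer l (Suc n))) x =
      (real n + 2 * l) * poly (gegenbauer l n) x - (real n + 1) * (x * poly (gegenbauer l (Suc n)) x)" for x
    using gegenbauer_derivative_shifts[where n = n and l = l and x = x] by algebra
  thus ?thesis
    by (intro iffD1[OF poly_eq_poly_eq_iff] ext) (simp add: algebra_simps del: gegenbauer.simps)
qed

lemma gegenbauer_differential_equation: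
  "(1 - x\<^sup>2) * poly (pderiv (pderiv (gegenbauer l n))) x =
     (2 * l + 1) * x * poly (pderiv (gegenbauer l n)) x
     - real n * (real n + 2 * l) * poly (gegenbauer l n) x"
proof (cases n)
  case 0
  thus ?thesis by (simp add: pderiv_1)
next
  case (Suc k)
  let ?C = "\<lambda>k. poly (gegenbauer l k) x" and ?D = "\<lambda>k. poly (pderiv (gegenbauer l k)) x"
  have "(1 - x\<^sup>2) * poly (pderiv (pderiv (gegenbauer l (Suc k)))) x - 2 * x * ?D (Suc k) =
      (real k + 2 * l) * ?D k - (real k + 1) * (?C (Suc k) + x * ?D (Suc k))"
    using arg_cong[OF gegenbauer_structure_relation[of l k], of "\<lambda>f. poly (pderiv f) x"]
    by (simp add: pderiv_smult pderiv_diff pderiv_mult pderiv_pCons algebra_simps power2_eq_square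
             del: gegenbauer.simps mult_pCons_left mult_pCons_right)
  moreover have "x * ?D (Suc k) - ?D k = (real k + 1) * ?C (Suc k)"
    by (rule gegenbauer_derivative_shifts)
  moreover have "real n = real k + 1" using Suc by simp
  ultimately show ?thesis unfolding Suc by algebra
qed

section \<open>Orthogonality and norms of the Gegenbauer polynomials\<close>

context
  fixes a l :: real
  assumes a: "a > 0" and l: "l = a + 1 / 2"
begin

text \<open>Multiplied by the weight, the differential equation takes the Sturm-Liouville form
  \<open>((1 - x\<^sup>2)\<^sup>a\<^sup>+\<^sup>1 C\<^sub>n')' = - n (n + 2 l) (1 - x\<^sup>2)\<^sup>a C\<^sub>n\<close>. The eigenvalues \<open>n (n + 2 l)\<close> are distinct,
  and integration by parts of the Wronskian \<open>f\<close> of \<open>C\<^sub>m\<close> and \<open>C\<^sub>n\<close> shows that the integral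
  times the difference of two eigenvalues is zero.\<close>

lemma gegenbauer_orthogonal:
  assumes "m \<noteq> n"
  shows "weighted_integral a (gegenbauer l m * gegenbauer l n) = 0"
proof -
  let ?C = "gegenbauer l"
  define f where "f = pderiv (?C n) * ?C m - ?C n * pderiv (?C m)"
  define c where "c = real m * (real m + 2 * l) - real n * (real n + 2 * l)"
  have "[:1, 0, -1:] * pderiv f - smult (2 * (a + 1)) ([:0, 1:] * f) = smult c (?C m * ?C n)"
  proof (intro iffD1[OF poly_eq_poly_eq_iff] ext)
    fix x
    have "poly ([:1, 0, -1:] * pderiv f - smult (2 * (a + 1)) ([:0, 1:] * f)) x =
       (1 - x\<^sup>2) * (poly (pderiv (pderiv (?C n))) x * poly (?C m) x
                  - poly (?C n) x * poly (pderiv (pderiv (?C m))) x)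
       - (2 * l + 1) * x * (poly (pderiv (?C n)) x * poly (?C m) x - poly (?C n) x * poly (pderiv (?C m)) x)"
      by (simp add: f_def l pderiv_diff pderiv_mult algebra_simps power2_eq_square)
    also have "\<dots> = c * (poly (?C m) x * poly (?C n) x)"
      using gegenbauer_differential_equation[of x l n] gegenbauer_differential_equation[of x l m] c_def
      by algebra
    finally show "poly ([:1, 0, -1:] * pderiv f - smult (2 * (a + 1)) ([:0, 1:] * f)) x =
        poly (smult c (?C m * ?C n)) x" by simp
  qed
  hence "c * weighted_integral a (?C m * ?C n) = 0"
    using weighted_integral_integration_by_parts[of "a + 1" f] a
    by (simp add: weighted_integral_smult del: mult_pCons_left mult_pCons_right)
  moreover have "c = (real m - real n) * (real m + real n + 2 * l)"
    by (simp add: c_def algebra_simps)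
  hence "c \<noteq> 0" using assms a l by simp
  ultimately show ?thesis by simp
qed

text \<open>The integral \<open>X\<^sub>n\<close> of \<open>x C\<^sub>n C\<^sub>n\<^sub>+\<^sub>1\<close> is evaluated twice: the recurrence for \<open>C\<^sub>n\<^sub>+\<^sub>2\<close>, tested against
  \<open>C\<^sub>n\<close>, expresses it by the norm of \<open>C\<^sub>n\<close>; the recurrence for \<open>C\<^sub>n\<^sub>+\<^sub>1\<close>, tested against \<open>C\<^sub>n\<^sub>+\<^sub>1\<close>,
  by that of \<open>C\<^sub>n\<^sub>+\<^sub>1\<close>. For \<open>n = 0\<close> the latter recurrence is replaced by \<open>C\<^sub>1 = 2 l x\<close>.\<close>

lemma gegenbauer_norm_step:
  "(real n + 1) * (real n + 1 + l) * weighted_integral a (gegenbauer l (Suc n) * gegenbauer l (Suc n)) =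
   (real n + l) * (real n + 2 * l) * weighted_integral a (gegenbauer l n * gegenbauer l n)"
proof -
  let ?C = "gegenbauer l"
  let ?h = "\<lambda>n. weighted_integral a (?C n * ?C n)"
  let ?X = "\<lambda>n. weighted_integral a ([:0, 1:] * ?C n * ?C (Suc n))"
  have a1: "a > -1" using a by simp
  have rec: "(real n + 2) * weighted_integral a (?C (Suc (Suc n)) * g) =
      2 * (real n + 1 + l) * weighted_integral a ([:0, 1:] * ?C (Suc n) * g)
      - (real n + 2 * l) * weighted_integral a (?C n * g)" for n g
  proof -
    have "smult (real n + 2) (?C (Suc (Suc n)) * g) =
       smult (2 * (real n + 1 + l)) ([:0, 1:] * ?C (Suc n) * g) - smult (real n + 2 * l) (?C n * g)"
      using arg_cong[OF gegenbauer_recurrence[of n l], of "\<lambda>f. f * g"]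
      by (simp add: left_diff_distrib del: gegenbauer.simps mult_pCons_left mult_pCons_right)
    from arg_cong[OF this, of "weighted_integral a"] show ?thesis
      by (simp only: weighted_integral_smult weighted_integral_diff[OF a1])
  qed
  have up: "2 * (real n + 1 + l) * ?X n = (real n + 2 * l) * ?h n"
  proof -
    have "[:0, 1:] * ?C (Suc n) * ?C n = [:0, 1:] * ?C n * ?C (Suc n)"
      by (simp only: mult_ac)
    hence X: "weighted_integral a ([:0, 1:] * ?C (Suc n) * ?C n) = ?X n" by (rule arg_cong)
    have "weighted_integral a (?C (Suc (Suc n)) * ?C n) = 0"
      by (intro gegenbauer_orthogonal) simp
    with rec[of n "?C n"] show ?thesis unfolding X by algebra
  qed
  have down: "(real n + 1) * ?h (Suc n) = 2 * (real n + l) * ?X n"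
  proof (cases n)
    case 0
    have "?C 1 * ?C 1 = smult (2 * l) ([:0, 1:] * ?C 0 * ?C (Suc 0))" by simp
    thus ?thesis using 0 by (metis weighted_integral_smult One_nat_def add.left_neutral mult_1 of_nat_0)
  next
    case (Suc k)
    thus ?thesis
      using rec[of k "?C (Suc (Suc k))"] gegenbauer_orthogonal[of k "Suc (Suc k)"]
      by (simp add: add.commute del: gegenbauer.simps mult_pCons_left mult_pCons_right)
  qed
  show ?thesis using up down by algebra
qed

lemma ultraspherical_a_squared:
  "(ultraspherical_a a n)\<^sup>2 = fact n * (real n + l) / Gamma (real n + 2 * l)"
proof -
  have "Gamma (real n + 2 * l) > 0" using a l by (intro Gamma_real_pos) simp
  moreover have "real n + l > 0" using a l by simp
  moreover have e: "real n + 1 + 2 * a = real n + 2 * l" "2 * real n + 2 * a + 1 = 2 * (real n + l)"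
    by (simp_all add: l)
  ultimately show ?thesis
    unfolding ultraspherical_a_def e by (subst real_sqrt_pow2, simp) (simp add: field_simps)
qed

lemma ultraspherical_a_pos: "ultraspherical_a a n > 0"
  using a Gamma_real_pos[of "real n + 1 + 2 * a"] by (simp add: ultraspherical_a_def)

lemma ultraspherical_a_times_b: "ultraspherical_a a n * ultraspherical_b a n = real n + l"
proof -
  define G where "G = Gamma (real n + 1 + 2 * a)"
  have G: "G > 0" unfolding G_def using a by (intro Gamma_real_pos) simp
  have "ultraspherical_a a n * ultraspherical_b a n = sqrt ((real n + l)\<^sup>2)"
    unfolding ultraspherical_a_def ultraspherical_b_def G_def[symmetric] real_sqrt_mult[symmetric]
    using G by (intro arg_cong[of _ _ sqrt]) (simp add: l field_simps power2_eq_square)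
  thus ?thesis using a l by simp
qed

text \<open>The Gamma quotient in \<open>a\<^sub>n\<^sup>2\<close> satisfies the reciprocal of the recursion of the squared norms.
  The constant on the right cancels from every entry of the differentiation matrix.\<close>

lemma gegenbauer_norm:
  "(ultraspherical_a a n)\<^sup>2 * weighted_integral a (gegenbauer l n * gegenbauer l n) =
   (ultraspherical_a a 0)\<^sup>2 * weighted_integral a 1"
proof (induction n)
  case 0
  show ?case by simp
next
  case (Suc n)
  define G where "G = Gamma (real n + 2 * l)"
  have pos: "real n + 2 * l > 0" "real n + l > 0" using a l by auto
  hence "real n + 2 * l \<notin> \<int>\<^sub>\<le>\<^sub>0" by (auto elim!: nonpos_Ints_cases)
  from Gamma_plus1[OF this] have G: "G > 0" "Gamma (real (Suc n) + 2 * l) = (real n + 2 * l) * G"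
    using pos(1) by (simp_all add: G_def add_ac)
  have "(ultraspherical_a a (Suc n))\<^sup>2 * weighted_integral a (gegenbauer l (Suc n) * gegenbauer l (Suc n)) =
      fact n * ((real n + 1) * (real n + 1 + l) * weighted_integral a (gegenbauer l (Suc n) * gegenbauer l (Suc n)))
        / ((real n + 2 * l) * G)"
    unfolding ultraspherical_a_squared G(2) by (simp add: algebra_simps del: gegenbauer.simps)
  also have "\<dots> = (ultraspherical_a a n)\<^sup>2 * weighted_integral a (gegenbauer l n * gegenbauer l n)"
    unfolding gegenbauer_norm_step ultraspherical_a_squared G_def[symmetric] using pos G(1) by simp
  finally show ?case using Suc.IH by simp
qed

text \<open>Raising \<open>m\<close> by two adds \<open>2 (m + 1 + l) C\<^sub>m\<^sub>+\<^sub>1\<close> to the derivative, and this contributes only when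
  \<open>n = m + 1\<close>. That is exactly the step at which \<open>m + 2\<close> first exceeds \<open>n\<close> with odd sum.\<close>

lemma gegenbauer_derivative_pairing:
  "weighted_integral a (pderiv (gegenbauer l m) * gegenbauer l n) =
     (if n < m \<and> odd (m + n)
      then 2 * (real n + l) * weighted_integral a (gegenbauer l n * gegenbauer l n) else 0)"
proof (induction m rule: induct_nat_012)
  case 0
  show ?case using weighted_integral_smult[of a 0 0] by (simp add: pderiv_1)
next
  case 1
  have "pderiv (gegenbauer l (Suc 0)) * gegenbauer l n = smult (2 * l) (gegenbauer l 0 * gegenbauer l n)"
    by (simp add: pderiv_pCons)
  thus ?case
    using gegenbauer_orthogonal[of 0 n]
    by (cases "n = 0") (auto simp: weighted_integral_smult simp del: gegenbauer.simps)
next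
  case (ge2 m)
  have a1: "a > -1" using a by simp
  have "pderiv (gegenbauer l (Suc (Suc m))) * gegenbauer l n =
      pderiv (gegenbauer l m) * gegenbauer l n
      + smult (2 * (real m + 1 + l)) (gegenbauer l (Suc m) * gegenbauer l n)"
  proof (intro iffD1[OF poly_eq_poly_eq_iff] ext)
    fix x
    show "poly (pderiv (gegenbauer l (Suc (Suc m))) * gegenbauer l n) x =
       poly (pderiv (gegenbauer l m) * gegenbauer l n
      + smult (2 * (real m + 1 + l)) (gegenbauer l (Suc m) * gegenbauer l n)) x"
      using gegenbauer_derivative_difference[of l m x]
      by (simp del: gegenbauer.simps) algebra
  qed
  hence step: "weighted_integral a (pderiv (gegenbauer l (Suc (Suc m))) * gegenbauer l n) =
      weighted_integral a (pderiv (gegenbauer l m) * gegenbauer l n)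
      + 2 * (real m + 1 + l) * weighted_integral a (gegenbauer l (Suc m) * gegenbauer l n)"
    by (simp only: weighted_integral_add[OF a1] weighted_integral_smult)
  show ?case
  proof (cases "n = Suc m")
    case True
    thus ?thesis unfolding step ge2.IH(1) by (simp add: add.commute del: gegenbauer.simps)
  next
    case False
    hence "weighted_integral a (gegenbauer l (Suc m) * gegenbauer l n) = 0"
      by (intro gegenbauer_orthogonal) simp
    moreover have "n < Suc (Suc m) \<and> odd (Suc (Suc m) + n) \<longleftrightarrow> n < m \<and> odd (m + n)"
      using False by (cases "n = m") auto
    ultimately show ?thesis unfolding step ge2.IH(1) by (simp only:)
  qed
qed

end

section \<open>Uniqueness of orthonormal polynomials\<close>

context
  fixes L :: "real poly \<Rightarrow> real" and p :: "nat \<Rightarrow> real poly"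
  assumes L_diff: "\<And>f g. L (f - g) = L f - L g"
    and L_smult: "\<And>c f. L (smult c f) = c * L f"
    and degree: "\<And>n. degree (p n) = n"
    and lead_coeff: "\<And>n. lead_coeff (p n) > 0"
    and orthonormal: "\<And>m n. L (p m * p n) = (if m = n then 1 else 0)"
begin

text \<open>Degree bounds are expressed through vanishing coefficients, since a bound by a natural number on
  the degree cannot single out the zero polynomial, where the inductions below start.\<close>

lemma orthonormal_reduce_degree:
  assumes "\<forall>i\<ge>Suc k. coeff f i = 0"
  shows "\<forall>i\<ge>k. coeff (f - smult (coeff f k / lead_coeff (p k)) (p k)) i = 0"
proof (intro allI impI)
  fix i assume "i \<ge> k"
  show "coeff (f - smult (coeff f k / lead_coeff (p k)) (p k)) i = 0"
  proof (cases "i = k")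
    case True
    thus ?thesis using lead_coeff[of k] degree[of k] by simp
  next
    case False
    with \<open>i \<ge> k\<close> have "coeff (p k) i = 0" by (intro coeff_eq_0) (simp add: degree)
    with False \<open>i \<ge> k\<close> assms show ?thesis by simp
  qed
qed

lemma orthonormal_orthogonal_to_lower_degree:
  assumes "\<forall>i\<ge>k. coeff f i = 0" "k \<le> n"
  shows "L (f * p n) = 0"
  using assms
proof (induction k arbitrary: f)
  case 0
  hence "f = 0" by (simp add: poly_eq_iff)
  moreover have "L 0 = 0" using L_smult[of 0 0] by (simp only: smult_0_left mult_zero_left)
  ultimately show ?case by (simp only: mult_zero_left)
next
  case (Suc k)
  define e where "e = coeff f k / lead_coeff (p k)"
  have "L ((f - smult e (p k)) * p n) = 0"
    unfolding e_def
    using Suc.prems(2) by (intro Suc.IH orthonormal_reduce_degree[OF Suc.prems(1)]) simp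
  thus ?case using Suc.prems(2)
    by (simp add: left_diff_distrib L_diff L_smult orthonormal)
qed

text \<open>The leading term of \<open>f\<close> is detected by pairing with the \<open>p\<^sub>k\<close> of the same degree, the lower
  terms being orthogonal to \<open>p\<^sub>k\<close>.\<close>

lemma orthogonal_to_orthonormal_imp_0:
  assumes "\<forall>i\<ge>k. coeff f i = 0" "\<forall>i<k. L (f * p i) = 0"
  shows "f = 0"
  using assms
proof (induction k)
  case 0
  thus ?case by (simp add: poly_eq_iff)
next
  case (Suc k)
  define e where "e = coeff f k / lead_coeff (p k)"
  have "L ((f - smult e (p k)) * p k) = 0"
    unfolding e_def
    by (rule orthonormal_orthogonal_to_lower_degree[OF orthonormal_reduce_degree[OF Suc.prems(1)] le_refl])
  moreover have "L (f * p k) = 0" using Suc.prems(2) by blast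
  ultimately have "e = 0" by (simp add: left_diff_distrib L_diff L_smult orthonormal)
  hence "coeff f k = 0" using lead_coeff[of k] by (auto simp: e_def)
  hence "coeff f i = 0" if "i \<ge> k" for i
    using that Suc.prems(1)[rule_format, of i] by (cases "i = k") auto
  hence "\<forall>i\<ge>k. coeff f i = 0" by blast
  moreover have "\<forall>i<k. L (f * p i) = 0" using Suc.prems(2) less_SucI by blast
  ultimately show ?case by (rule Suc.IH)
qed

end

text \<open>The difference between \<open>q\<^sub>n\<close> and its projection \<open>c p\<^sub>n\<close> onto \<open>p\<^sub>n\<close> is orthogonal to all \<open>p\<^sub>i\<close> with
  \<open>i \<le> n\<close>, hence zero. Normalisation gives \<open>c\<^sup>2 = 1\<close>, and the sign of the leading coefficients
  gives \<open>c = 1\<close>.\<close>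

lemma orthonormal_polys_unique:
  assumes int: "\<And>f. set_integrable lborel S (\<lambda>x. w x * poly f x)"
    and p: "orthonormal_polys S w p" and q: "orthonormal_polys S w q"
  shows "q = p"
proof
  fix n
  define L where "L = (\<lambda>f. LINT x:S|lborel. w x * poly f x)"
  have L_diff: "L (f - g) = L f - L g" for f g
    using set_integral_diff(2)[OF int int, of f g] by (simp add: L_def right_diff_distrib)
  have L_smult: "L (smult c f) = c * L f" for c f
    by (simp add: L_def mult.left_commute)
  have deg: "degree (p n) = n" "lead_coeff (p n) > 0" "degree (q n) = n" "lead_coeff (q n) > 0" for n
    using p q unfolding orthonormal_polys_def by blast+
  have lc: "coeff (p n) n > 0" "coeff (q n) n > 0" for n
    using deg(2,4)[of n] by (simp_all add: deg)
  have orth: "L (p m * p n) = (if m = n then 1 else 0)" "L (q m * q n) = (if m = n then 1 else 0)" for m n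
    using p q by (simp_all add: orthonormal_polys_def L_def mult.assoc)
  define c where "c = L (q n * p n)"
  have "q n - smult c (p n) = 0"
  proof (rule orthogonal_to_orthonormal_imp_0[where L = L and p = p and k = "Suc n"])
    show "\<forall>i\<ge>Suc n. coeff (q n - smult c (p n)) i = 0"
      by (auto simp: coeff_eq_0 deg)
    show "\<forall>i<Suc n. L ((q n - smult c (p n)) * p i) = 0"
    proof (intro allI impI)
      fix i assume i: "i < Suc n"
      have "L (p i * q n) = 0" if "i < n"
        using that by (intro orthonormal_orthogonal_to_lower_degree[where L = L and p = q and k = "Suc i"])
          (auto simp: L_diff L_smult deg lc orth coeff_eq_0)
      moreover have "L ((q n - smult c (p n)) * p i) = L (p i * q n) - c * L (p n * p i)"
        by (simp add: left_diff_distrib L_diff L_smult mult.commute[of "p i"])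
      ultimately show "L ((q n - smult c (p n)) * p i) = 0"
        using i by (cases "i = n") (auto simp: orth c_def mult.commute[of "q n"])
    qed
  qed (auto simp: L_diff L_smult deg lc orth)
  hence qn: "q n = smult c (p n)" by simp
  have "c > 0" using lc(2)[of n] lc(1)[of n] unfolding qn by (simp add: zero_less_mult_iff)
  moreover have "c * c = 1" using orth(2)[of n n] unfolding qn by (simp add: L_smult orth)
  hence "(c - 1) * (c + 1) = 0" by algebra
  ultimately have "c = 1" by simp
  with qn show "q n = p n" by simp
qed

lemma orthonormal_poly_eqI:
  assumes "\<And>f. set_integrable lborel S (\<lambda>x. w x * poly f x)" "orthonormal_polys S w p"
  shows "orthonormal_poly S w = p"
  unfolding orthonormal_poly_def
  using assms by (intro the_equality orthonormal_polys_unique)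

section \<open>The ultraspherical differentiation matrix\<close>

text \<open>The integrand splits into half of \<open>w (p\<^sub>m' p\<^sub>n - p\<^sub>n' p\<^sub>m)\<close> and half of the derivative of
  \<open>w p\<^sub>m p\<^sub>n\<close>, in the proof written with the polynomials \<open>u\<close> and \<open>v\<close>.\<close>

lemma diff_matrix_ultraspherical:
  assumes a: "a > 0"
  defines "p \<equiv> orthonormal_poly {-1<..<1} (ultraspherical_weight a)"
  shows "diff_matrix {-1<..<1} (ultraspherical_weight a) m n =
     (weighted_integral a (pderiv (p m) * p n) - weighted_integral a (pderiv (p n) * p m)) / 2"
proof -
  have W: "W_function {-1<..<1} (ultraspherical_weight a) k = (\<lambda>x. (1 - x\<^sup>2) powr (a / 2) * poly (p k) x)" for k
    by (rule ext) (simp add: W_function_def p_def ultraspherical_weight_def powr_powr flip: powr_half_sqrt)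
  define f where "f = p m * p n"
  define u where "u = pderiv (p m) * p n - pderiv (p n) * p m"
  define v where "v = [:1, 0, -1:] * pderiv f - smult (2 * a) ([:0, 1:] * f)"
  have "diff_matrix {-1<..<1} (ultraspherical_weight a) m n =
     (LINT x:{-1<..<1}|lborel. (1 - x\<^sup>2) powr a * poly (smult (1/2) u) x
                              + (1 - x\<^sup>2) powr (a - 1) * poly (smult (1/2) v) x)"
    unfolding diff_matrix_def
  proof (rule set_lebesgue_integral_cong, simp, intro allI impI)
    fix x :: real assume x: "x \<in> {-1<..<1}"
    define y where "y = 1 - x\<^sup>2"
    have y: "y > 0" using x by (simp add: y_def abs_square_less_1 abs_less_iff)
    have D: "deriv (W_function {-1<..<1} (ultraspherical_weight a) m) x =
        y powr (a/2) * poly (pderiv (p m)) x - a * x * y powr (a/2 - 1) * poly (p m) x"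
      unfolding W using y unfolding y_def
      by (intro DERIV_imp_deriv) (auto intro!: derivative_eq_intros simp: algebra_simps)
    have e: "y powr (a/2) * y powr (a/2) = y * y powr (a - 1)"
       "y powr (a/2 - 1) * y powr (a/2) = y powr (a - 1)"
       "y powr a = y * y powr (a - 1)"
      using y by (simp_all add: powr_diff flip: powr_add)
    have "deriv (W_function {-1<..<1} (ultraspherical_weight a) m) x *
          W_function {-1<..<1} (ultraspherical_weight a) n x =
        (y powr (a/2) * y powr (a/2)) * (poly (pderiv (p m)) x * poly (p n) x)
        - a * x * (y powr (a/2 - 1) * y powr (a/2)) * (poly (p m) x * poly (p n) x)"
      unfolding D unfolding W y_def[symmetric] by (simp add: algebra_simps)
    also have "\<dots> = y powr a * poly (smult (1/2) u) x + y powr (a - 1) * poly (smult (1/2) v) x"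
      unfolding e by (simp add: u_def v_def f_def y_def pderiv_mult field_simps power2_eq_square)
    finally show "deriv (W_function {-1<..<1} (ultraspherical_weight a) m) x *
          W_function {-1<..<1} (ultraspherical_weight a) n x =
        (1 - x\<^sup>2) powr a * poly (smult (1/2) u) x + (1 - x\<^sup>2) powr (a - 1) * poly (smult (1/2) v) x"
      by (simp add: y_def)
  qed
  also have "\<dots> = weighted_integral a (smult (1/2) u) + weighted_integral (a - 1) (smult (1/2) v)"
    unfolding weighted_integral_def using a by (intro set_integral_add(2) weight_poly_integrable) auto
  also have "\<dots> = weighted_integral a u / 2"
    using weighted_integral_integration_by_parts[OF a, of f] by (simp add: weighted_integral_smult v_def)
  finally show ?thesis using a by (simp add: u_def weighted_integral_diff)
qed

lemma ultraspherical_symmetrically_separable_via: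
  assumes a: "a > 0"
  shows "symmetrically_separable_via {-1<..<1} (ultraspherical_weight a)
           (ultraspherical_a a) (ultraspherical_b a)"
proof -
  let ?S = "{-1<..<1::real}" and ?w = "ultraspherical_weight a"
  let ?a = "ultraspherical_a a" and ?b = "ultraspherical_b a"
  define l where "l = a + 1 / 2"
  define C where "C = gegenbauer l"
  define K where "K = (?a 0)\<^sup>2 * weighted_integral a 1"
  have lpos: "l > 0" using a by (simp add: l_def)
  have apos: "?a n > 0" for n by (rule ultraspherical_a_pos[OF a l_def])
  have K: "K > 0" unfolding K_def using apos[of 0] weighted_integral_one_pos[OF a] by simp
  \<comment> \<open>By the next fact, the norm of \<open>C n\<close> is \<open>sqrt K / ?a n\<close>.\<close>
  define p where "p = (\<lambda>n. smult (?a n / sqrt K) (C n))"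
  have norm: "(?a n)\<^sup>2 * weighted_integral a (C n * C n) = K" for n
    unfolding C_def K_def by (rule gegenbauer_norm[OF a l_def])
  have pp: "weighted_integral a (p m * p n) = (if m = n then 1 else 0)" for m n
    using norm[of n] gegenbauer_orthogonal[OF a l_def, of m n] K
    by (auto simp: p_def weighted_integral_smult C_def power2_eq_square field_simps)
  have deg: "degree (p n) = n \<and> lead_coeff (p n) > 0" for n
  proof -
    have "\<forall>i>n. coeff (C n) i = 0" "coeff (C n) n > 0"
      using gegenbauer_coeffs[OF lpos, of n] by (auto simp: C_def)
    hence "degree (C n) = n" by (metis coeff_0 degree_le le_antisym le_degree order_less_irrefl)
    thus ?thesis using \<open>coeff (C n) n > 0\<close> apos[of n] K by (simp add: p_def)
  qed
  have int: "set_integrable lborel ?S (\<lambda>x. ?w x * poly f x)" for f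
    using weight_poly_integrable[of a f] a by (simp add: ultraspherical_weight_def)
  have "orthonormal_polys ?S ?w p"
    unfolding orthonormal_polys_def
  proof (intro conjI allI)
    fix m n
    show "set_integrable lborel ?S (\<lambda>x. ?w x * poly (p m) x * poly (p n) x)"
      using int[of "p m * p n"] by (simp add: mult.assoc)
    show "(LINT x:?S|lborel. ?w x * poly (p m) x * poly (p n) x) = (if m = n then 1 else 0)"
      using pp[of m n] by (simp add: weighted_integral_def ultraspherical_weight_def mult.assoc)
  qed (use deg in blast)+
  hence "orthonormal_poly ?S ?w = p" by (intro orthonormal_poly_eqI int)
  hence D: "diff_matrix ?S ?w m n =
     (weighted_integral a (pderiv (p m) * p n) - weighted_integral a (pderiv (p n) * p m)) / 2" for m n
    using diff_matrix_ultraspherical[OF a, of m n] by simp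
  have E: "weighted_integral a (pderiv (p m) * p n) = (if n < m \<and> odd (m + n) then 2 * (?a m * ?b n) else 0)"
    for m n
  proof -
    have "weighted_integral a (pderiv (p m) * p n) =
        ?a m * ?a n / K * weighted_integral a (pderiv (C m) * C n)"
      using K by (simp add: p_def pderiv_smult weighted_integral_smult)
    also have "\<dots> = (if n < m \<and> odd (m + n) then 2 * (?a m * ?b n) else 0)"
    proof -
      have "?a m * ?a n / K * (2 * (real n + l) * weighted_integral a (C n * C n)) = 2 * (?a m * ?b n)"
      proof -
        have "weighted_integral a (C n * C n) \<noteq> 0" using norm[of n] K by auto
        thus ?thesis
          using apos[of n] by (simp add: norm[of n, symmetric] power2_eq_square
            flip: ultraspherical_a_times_b[OF a l_def, of n])
      qed
      thus ?thesis
        using gegenbauer_derivative_pairing[OF a l_def, of m n] by (simp add: C_def)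
    qed
    finally show ?thesis .
  qed
  show ?thesis
    unfolding symmetrically_separable_via_def D E by (auto simp: add.commute)
qed

theorem mainTheorem9:
  fixes \<alpha> :: real
  assumes "\<alpha> > 0"
  shows "symmetrically_separable {-1<..<1} (ultraspherical_weight \<alpha>) \<and>
         symmetrically_separable_via {-1<..<1} (ultraspherical_weight \<alpha>)
           (ultraspherical_a \<alpha>) (ultraspherical_b \<alpha>) \<and>
         (\<forall>m n. odd (m + n) \<and> m \<ge> n + 1 \<longrightarrow>
           diff_matrix {-1<..<1} (ultraspherical_weight \<alpha>) m n =
             1 / 2 * sqrt (fact m * (2 * real m + 2 * \<alpha> + 1) * (2 * real n + 2 * \<alpha> + 1)
                             * Gamma (real n + 1 + 2 * \<alpha>)
                           / (fact n * Gamma (real m + 1 + 2 * \<alpha>))))"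
proof -
  have sep: "symmetrically_separable_via {-1<..<1} (ultraspherical_weight \<alpha>)
           (ultraspherical_a \<alpha>) (ultraspherical_b \<alpha>)"
    using assms by (rule ultraspherical_symmetrically_separable_via)
  have "ultraspherical_a \<alpha> m * ultraspherical_b \<alpha> n =
      1 / 2 * sqrt (fact m * (2 * real m + 2 * \<alpha> + 1) * (2 * real n + 2 * \<alpha> + 1)
                             * Gamma (real n + 1 + 2 * \<alpha>)
                           / (fact n * Gamma (real m + 1 + 2 * \<alpha>)))" (is "_ = 1 / 2 * sqrt ?X") for m n
  proof -
    have "ultraspherical_a \<alpha> m * ultraspherical_b \<alpha> n = sqrt (?X / 4)"
      unfolding ultraspherical_a_def ultraspherical_b_def real_sqrt_mult[symmetric]
      by (simp add: mult_ac)
    also have "\<dots> = 1 / 2 * sqrt ?X" unfolding real_sqrt_divide[of ?X 4] by simp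
    finally show ?thesis .
  qed
  moreover have "diff_matrix {-1<..<1} (ultraspherical_weight \<alpha>) m n = ultraspherical_a \<alpha> m * ultraspherical_b \<alpha> n"
    if "odd (m + n) \<and> m \<ge> n + 1" for m n
    using sep that unfolding symmetrically_separable_via_def by blast
  ultimately show ?thesis
    using sep unfolding symmetrically_separable_def by (intro conjI) (blast, blast, simp)
qed

end
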